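(* There is a quiescently stabilizing content-oblivious algorithm of message complexity $n(2\cdot\mathrm{ID}_{\max}+1)$ that elects a leader and orients a non-oriented ring of $n$ nodes with unique IDs, where $\mathrm{ID}_{\max}$ is the largest ID assigned to a node.
   Context: Content-oblivious model: a ring of $n$ nodes, each node having two ports (Port 0 and Port 1), each connected by a bidirectional channel to one of its two neighbours. Messages are content-free pulses. The network is asynchronous: every pulse is delivered after an arbitrary finite delay; pulses are never lost or injected. Nodes are event-driven (act once at the start and then only upon processing a received pulse), and their behaviour depends only on their own ID and the sequence of pulses received so far (with ports). Algorithms are uniform (nodes do not know $n$). Each node $v$ has a unique ID $\mathrm{ID}(v)\in\mathbb{N}$, and $\mathrm{ID}_{\max}=\max_v\mathrm{ID}(v)$. The ring is non-oriented: the assignment of Port 0/Port 1 to the two neighbours of each node is arbitrary, and the algorithm must work for all such assignments. Quiescently stabilizing algorithm: nodes need not terminate; it is required that eventually no pulses are in transit (quiescence), and at that time the internal states are correct (hence never change again). Here correctness means: exactly one node has state Leader and all others Non-Leader, and each node has labelled exactly one of its ports as its clockwise port such that starting at any node and repeatedly moving to the neighbour at the clockwise port passes through all edges of the ring. Message complexity: total number of pulses sent in a worst-case execution until quiescence. *)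

theory Defs
  imports Main "HOL-Library.Extended_Nat"
begin

section \<open>Non-oriented rings\<close>

datatype port = Port0 | Port1

fun other_port :: "port \<Rightarrow> port" where
  "other_port Port0 = Port1"
| "other_port Port1 = Port0"

text \<open>
  The nodes are the positions \<open>0, \<dots>, num_nodes - 1\<close>, listed in order around the ring.
  Positions are not visible to an algorithm. The arbitrary function \<open>next_port\<close> tells which
  port of a position leads to the succeeding position; the other port leads to the preceding one.
  With one node, the two ports of this node are connected to each other; with two nodes there are
  two parallel channels.
\<close>

record ring =
  num_nodes :: nat
  ID :: "nat \<Rightarrow> nat"
  next_port :: "nat \<Rightarrow> port"

definition valid_ring :: "ring \<Rightarrow> bool" where
  "valid_ring R \<longleftrightarrow> 1 \<le> num_nodes R \<and> inj_on (ID R) {..<num_nodes R}"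

definition ID_max :: "ring \<Rightarrow> nat" where
  "ID_max R = Max (ID R ` {..<num_nodes R})"

type_synonym endpoint = "nat \<times> port"

definition endpoints :: "ring \<Rightarrow> endpoint set" where
  "endpoints R = {..<num_nodes R} \<times> UNIV"

definition peer :: "ring \<Rightarrow> endpoint \<Rightarrow> endpoint" where
  "peer R x = (case x of (v, p) \<Rightarrow>
     if p = next_port R v
     then (let w = (v + 1) mod num_nodes R in (w, other_port (next_port R w)))
     else (let w = (v + num_nodes R - 1) mod num_nodes R in (w, next_port R w)))"

text \<open>An edge is the set of its two endpoints, so that parallel edges stay distinct.\<close>

definition edge_at :: "ring \<Rightarrow> endpoint \<Rightarrow> endpoint set" where
  "edge_at R x = {x, peer R x}"

definition edges :: "ring \<Rightarrow> endpoint set set" where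
  "edges R = edge_at R ` endpoints R"


section \<open>Content-oblivious algorithms\<close>

datatype role = Undecided | Leader | Non_Leader

text \<open>
  All components take the ID of the node and the sequence of ports at which the node has received
  pulses so far (oldest first). \<open>send a h p\<close> is the number of pulses sent through port \<open>p\<close> right
  after the last pulse of \<open>h\<close> has been processed, or at the start if \<open>h = []\<close>. The components
  \<open>role\<close> and \<open>clockwise\<close> give the part of the internal state that is the current
  output: the election state and the set of ports labelled as clockwise.
\<close>

record algorithm =
  send :: "nat \<Rightarrow> port list \<Rightarrow> port \<Rightarrow> nat"
  role :: "nat \<Rightarrow> port list \<Rightarrow> role"
  clockwise :: "nat \<Rightarrow> port list \<Rightarrow> port set"


section \<open>Asynchronous executions\<close>

text \<open>
  \<open>transit C x\<close> is the number of pulses that were sent from the endpoint \<open>x\<close> and are not yet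
  delivered (at \<open>peer R x\<close>); thus \<open>x\<close> stands for one direction of a channel. \<open>sent C\<close> is the
  total number of pulses sent so far.
\<close>

record config =
  history :: "nat \<Rightarrow> port list"
  transit :: "endpoint \<Rightarrow> nat"
  sent :: nat

text \<open>
  All nodes have acted at the start. A node that wakes up late is covered by delaying the pulses
  addressed to it and those sent by it.
\<close>

definition initial :: "algorithm \<Rightarrow> ring \<Rightarrow> config" where
  "initial A R =
     \<lparr> history = (\<lambda>v. []),
       transit = (\<lambda>(v, q). send A (ID R v) [] q),
       sent = (\<Sum>v<num_nodes R. send A (ID R v) [] Port0 + send A (ID R v) [] Port1) \<rparr>"

definition deliver :: "algorithm \<Rightarrow> ring \<Rightarrow> endpoint \<Rightarrow> config \<Rightarrow> config" where
  "deliver A R x C =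
     (let (v, p) = peer R x;
          h = history C v @ [p];
          s = send A (ID R v) h
      in \<lparr> history = (history C)(v := h),
           transit = (\<lambda>(w, q). transit C (w, q) - (if (w, q) = x then 1 else 0)
                                 + (if w = v then s q else 0)),
           sent = sent C + s Port0 + s Port1 \<rparr>)"

text \<open>A schedule tells which channel delivers a pulse at each time; \<open>None\<close> is an idle time.\<close>

type_synonym schedule = "nat \<Rightarrow> endpoint option"

primrec run :: "algorithm \<Rightarrow> ring \<Rightarrow> schedule \<Rightarrow> nat \<Rightarrow> config" where
  "run A R \<sigma> 0 = initial A R"
| "run A R \<sigma> (Suc t) =
     (case \<sigma> t of None \<Rightarrow> run A R \<sigma> t | Some x \<Rightarrow> deliver A R x (run A R \<sigma> t))"

text \<open>
  The first condition says that pulses are not injected, the second one that every pulse is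
  delivered after a finite delay. Since pulses are indistinguishable, the latter amounts to
  serving every nonempty channel eventually.
\<close>

definition admissible :: "algorithm \<Rightarrow> ring \<Rightarrow> schedule \<Rightarrow> bool" where
  "admissible A R \<sigma> \<longleftrightarrow>
     (\<forall>t x. \<sigma> t = Some x \<longrightarrow> x \<in> endpoints R \<and> 0 < transit (run A R \<sigma> t) x) \<and>
     (\<forall>t. \<forall>x \<in> endpoints R. 0 < transit (run A R \<sigma> t) x \<longrightarrow> (\<exists>t'\<ge>t. \<sigma> t' = Some x))"

definition quiescent :: "ring \<Rightarrow> config \<Rightarrow> bool" where
  "quiescent R C \<longleftrightarrow> (\<forall>x \<in> endpoints R. transit C x = 0)"


section \<open>Leader election and orientation\<close>

definition elected :: "algorithm \<Rightarrow> ring \<Rightarrow> config \<Rightarrow> bool" where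
  "elected A R C \<longleftrightarrow>
     (\<exists>l<num_nodes R. role A (ID R l) (history C l) = Leader \<and>
        (\<forall>v<num_nodes R. v \<noteq> l \<longrightarrow> role A (ID R v) (history C v) = Non_Leader))"

definition walk :: "ring \<Rightarrow> (nat \<Rightarrow> port) \<Rightarrow> nat \<Rightarrow> nat \<Rightarrow> nat" where
  "walk R c v k = ((\<lambda>w. fst (peer R (w, c w))) ^^ k) v"

definition oriented :: "algorithm \<Rightarrow> ring \<Rightarrow> config \<Rightarrow> bool" where
  "oriented A R C \<longleftrightarrow>
     (\<exists>c. (\<forall>v<num_nodes R. clockwise A (ID R v) (history C v) = {c v}) \<and>
        (\<forall>v<num_nodes R. \<forall>e \<in> edges R. \<exists>k. edge_at R (walk R c v k, c (walk R c v k)) = e))"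

text \<open>
  As nodes act only upon receiving a pulse, configurations no longer change once they are
  quiescent.
\<close>

definition quiescently_stabilizes ::
  "algorithm \<Rightarrow> ring \<Rightarrow> (config \<Rightarrow> bool) \<Rightarrow> bool" where
  "quiescently_stabilizes A R correct \<longleftrightarrow>
     (\<forall>\<sigma>. admissible A R \<sigma> \<longrightarrow> (\<exists>t. quiescent R (run A R \<sigma> t) \<and> correct (run A R \<sigma> t)))"

definition message_complexity :: "algorithm \<Rightarrow> ring \<Rightarrow> enat" where
  "message_complexity A R = (SUP \<sigma> \<in> {\<sigma>. admissible A R \<sigma>}. SUP t. enat (sent (run A R \<sigma> t)))"

end

theory Submission
  imports Defs
begin

text \<open>
  The two directions of the ring are used independently. In each direction, every node sends one
  pulse at the start and forwards all incoming pulses except one: a node with ID \<open>i\<close> swallows the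
  \<open>i\<close>-th pulse received at \<open>Port0\<close> and the \<open>(i + 1)\<close>-th pulse received at \<open>Port1\<close> (the ``0-th
  pulse'' being the one sent at the start). In a direction where \<open>M\<close> is the largest of these
  thresholds, no node ever receives more than \<open>M\<close> pulses; at quiescence all nodes have received
  equally many, and as no node may then have a pulse in surplus, everyone has swallowed one, so the
  common number is \<open>M\<close>. The node of maximal ID has both thresholds maximal in their directions, so
  one direction carries \<open>ID_max + 1\<close> pulses per node and the other \<open>ID_max\<close>. This asymmetry
  orients the ring, and the leader is the only node that sees \<open>ID + 1\<close> as the larger number.
\<close>

section \<open>The algorithm\<close>

definition threshold :: "nat \<Rightarrow> port \<Rightarrow> nat" where
  "threshold i p = i + (if p = Port1 then 1 else 0)"

text \<open>For \<open>h = []\<close> the count is 0, so a node with threshold 0 swallows its own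
  initial pulse.\<close>

definition election :: algorithm where
  "election =
     \<lparr> send = (\<lambda>i h q. if (h = [] \<or> last h = other_port q) \<and>
                         count_list h (other_port q) \<noteq> threshold i (other_port q) then 1 else 0),
       role = (\<lambda>i h. if max (count_list h Port0) (count_list h Port1) = i + 1
                     then Leader else Non_Leader),
       clockwise = (\<lambda>i h. {p. count_list h (other_port p) < count_list h p}) \<rparr>"

text \<open>Closed form of the total sent through \<open>q\<close> during \<open>h\<close>: the
  initial pulse plus one per arrival opposite \<open>q\<close>, less one once the threshold is
  reached.\<close>

definition emitted :: "nat \<Rightarrow> port list \<Rightarrow> port \<Rightarrow> nat" where
  "emitted i h q = count_list h (other_port q) +
     (if count_list h (other_port q) < threshold i (other_port q) then 1 else 0)"

lemma emitted_Nil: "emitted i [] q = send election i [] q"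
  by (simp add: emitted_def election_def)

lemma emitted_snoc: "emitted i (h @ [p]) q = emitted i h q + send election i (h @ [p]) q"
  by (auto simp: emitted_def election_def)

section \<open>Geometry of the ring\<close>

lemma UNIV_port: "UNIV = {Port0, Port1}"
  using port.exhaust by auto

lemma other_port_other_port [simp]: "other_port (other_port p) = p"
  by (cases p) auto

lemma other_port_neq [simp]: "other_port p \<noteq> p" "p \<noteq> other_port p"
  by (cases p; simp)+

lemma neq_port_iff: "p \<noteq> q \<longleftrightarrow> p = other_port q"
  by (cases p; cases q) auto

lemma finite_endpoints [simp]: "finite (endpoints R)"
  by (simp add: endpoints_def UNIV_port)

lemma sum_endpoints:
  "(\<Sum>x\<in>endpoints R. f x) = (\<Sum>v<num_nodes R. f (v, Port0) + f (v, Port1))"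
  by (simp add: endpoints_def sum.cartesian_product' UNIV_port)

text \<open>Crosses a node as \<open>peer\<close> crosses a channel: pulses arriving at
  \<open>flip x\<close> are forwarded through \<open>x\<close>.\<close>

definition flip :: "endpoint \<Rightarrow> endpoint" where
  "flip x = (fst x, other_port (snd x))"

lemma flip_flip [simp]: "flip (flip x) = x"
  by (simp add: flip_def)

lemma bij_flip: "bij_betw flip (endpoints R) (endpoints R)"
  by (rule bij_betw_byWitness[where f' = flip]) (auto simp: flip_def endpoints_def)

lemma mod_succ_pred: "v < n \<Longrightarrow> ((v + n - 1) mod n + 1) mod n = (v::nat)"
  by (cases "v = 0") (auto simp: mod_if)

lemma mod_pred_succ: "v < n \<Longrightarrow> ((v + 1) mod n + n - 1) mod n = (v::nat)"
  by (cases "v + 1 = n") auto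

lemma peer_next:
  "peer R (v, next_port R v) =
     ((v + 1) mod num_nodes R, other_port (next_port R ((v + 1) mod num_nodes R)))"
  by (simp add: peer_def Let_def)

lemma peer_prev:
  "peer R (v, other_port (next_port R v)) =
     ((v + num_nodes R - 1) mod num_nodes R, next_port R ((v + num_nodes R - 1) mod num_nodes R))"
  by (simp add: peer_def Let_def)

lemma endpoint_cases:
  assumes "x \<in> endpoints R"
  obtains v where "v < num_nodes R" "x = (v, next_port R v)"
    | v where "v < num_nodes R" "x = (v, other_port (next_port R v))"
  using assms neq_port_iff by (cases x) (auto simp: endpoints_def)

lemma peer_in_endpoints: "x \<in> endpoints R \<Longrightarrow> peer R x \<in> endpoints R"
  by (erule endpoint_cases) (auto simp: peer_next peer_prev endpoints_def)

lemma peer_peer: "x \<in> endpoints R \<Longrightarrow> peer R (peer R x) = x"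
  by (erule endpoint_cases)
     (simp_all add: peer_next peer_prev mod_pred_succ[simplified] mod_succ_pred[simplified])

lemma bij_peer: "bij_betw (peer R) (endpoints R) (endpoints R)"
  by (rule bij_betw_byWitness[where f' = "peer R"]) (auto simp: peer_peer peer_in_endpoints)

lemma edge_at_peer: "x \<in> endpoints R \<Longrightarrow> edge_at R (peer R x) = edge_at R x"
  by (auto simp: edge_at_def peer_peer)

section \<open>Walks that keep one direction\<close>

lemma walk_next:
  "v < num_nodes R \<Longrightarrow> walk R (next_port R) v k = (v + k) mod num_nodes R"
  by (induction k) (simp_all add: walk_def peer_next mod_Suc_eq)

lemma walk_prev:
  assumes "v < num_nodes R"
  shows "walk R (\<lambda>w. other_port (next_port R w)) v k = (v + k * (num_nodes R - 1)) mod num_nodes R"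
proof (induction k)
  case 0
  then show ?case using assms by (simp add: walk_def)
next
  case (Suc k)
  obtain m where m: "num_nodes R = Suc m" using assms by (cases "num_nodes R") auto
  then show ?case
    using Suc by (simp add: walk_def peer_prev mod_add_right_eq add.commute[of _ m] add.left_commute)
qed

lemma walk_next_surj:
  assumes "v < num_nodes R" "w < num_nodes R"
  shows "\<exists>k. walk R (next_port R) v k = w"
  using assms by (intro exI[of _ "w + num_nodes R - v"]) (simp add: walk_next)

lemma walk_prev_surj:
  assumes "v < num_nodes R" "w < num_nodes R"
  shows "\<exists>k. walk R (\<lambda>u. other_port (next_port R u)) v k = w"
proof -
  let ?n = "num_nodes R"
  \<comment> \<open>\<open>Suc d\<close> backward steps lead from \<open>v\<close> to
    \<open>w\<close> modulo \<open>?n\<close>; adding \<open>?n\<close> keeps the difference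
    positive.\<close>
  obtain d where d: "v + ?n = w + Suc d" using assms by (metis add.commute less_imp_add_positive
        trans_less_add2 add_Suc_right gr0_implies_Suc)
  obtain m where m: "?n = Suc m" using assms by (cases ?n) auto
  have "v + Suc d * (?n - 1) = w + d * ?n"
    using d by (simp add: m algebra_simps)
  then show ?thesis
    using assms by (intro exI[of _ "Suc d"]) (simp add: walk_prev)
qed

text \<open>Every edge has exactly the form needed at one of its ends: if \<open>x\<close> points
  backward, its peer points forward.\<close>

lemma next_port_covers_edges:
  assumes "v < num_nodes R" "e \<in> edges R"
  shows "\<exists>k. edge_at R (walk R (next_port R) v k, next_port R (walk R (next_port R) v k)) = e"
proof -
  obtain x where x: "x \<in> endpoints R" "e = edge_at R x" using assms by (auto simp: edges_def)
  then obtain w where "w < num_nodes R" "e = edge_at R (w, next_port R w)"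
    by (metis edge_at_peer endpoint_cases peer_prev peer_in_endpoints mem_Sigma_iff
        endpoints_def lessThan_iff)
  then show ?thesis using walk_next_surj assms(1) by metis
qed

lemma prev_port_covers_edges:
  fixes R defines "c \<equiv> \<lambda>w. other_port (next_port R w)"
  assumes "v < num_nodes R" "e \<in> edges R"
  shows "\<exists>k. edge_at R (walk R c v k, c (walk R c v k)) = e"
proof -
  obtain x where x: "x \<in> endpoints R" "e = edge_at R x" using assms by (auto simp: edges_def)
  then obtain w where "w < num_nodes R" "e = edge_at R (w, c w)"
    unfolding c_def
    by (metis edge_at_peer endpoint_cases peer_next peer_in_endpoints mem_Sigma_iff
        endpoints_def lessThan_iff)
  then show ?thesis using walk_prev_surj assms(2) unfolding c_def by metis
qed

section \<open>Counting pulses\<close>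

definition received :: "config \<Rightarrow> endpoint \<Rightarrow> nat" where
  "received C x = count_list (history C (fst x)) (snd x)"

definition sent_through :: "ring \<Rightarrow> config \<Rightarrow> endpoint \<Rightarrow> nat" where
  "sent_through R C x = emitted (ID R (fst x)) (history C (fst x)) (snd x)"

lemma sent_through_eq:
  "sent_through R C x = received C (flip x) +
     (if received C (flip x) < threshold (ID R (fst x)) (snd (flip x)) then 1 else 0)"
  by (simp add: sent_through_def received_def emitted_def flip_def)

lemma received_deliver:
  "received (deliver A R x C) y = received C y + (if y = peer R x then 1 else 0)"
  by (cases y) (auto simp: received_def deliver_def Let_def split: prod.splits)

text \<open>The increase of \<open>sent_through\<close> is what the delivery puts into transit; it
  is spread over both sides to avoid natural subtraction.\<close>

lemma transit_deliver:
  "transit (deliver election R x C) y + sent_through R C y =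
     transit C y - (if y = x then 1 else 0) + sent_through R (deliver election R x C) y"
  by (cases y) (auto simp: sent_through_def deliver_def Let_def emitted_snoc split: prod.splits)

lemma sent_deliver:
  assumes "x \<in> endpoints R"
  shows "sent (deliver election R x C) + (\<Sum>y\<in>endpoints R. sent_through R C y) =
    sent C + (\<Sum>y\<in>endpoints R. sent_through R (deliver election R x C) y)"
proof -
  obtain v p where vp: "peer R x = (v, p)" by fastforce
  then have v: "v < num_nodes R" using peer_in_endpoints[OF assms] by (simp add: endpoints_def)
  let ?s = "send election (ID R v) (history C v @ [p])"
  have "(\<Sum>y\<in>endpoints R. sent_through R (deliver election R x C) y) =
      (\<Sum>w<num_nodes R. (sent_through R C (w, Port0) + sent_through R C (w, Port1)) +
        (if w = v then ?s Port0 + ?s Port1 else 0))"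
    unfolding sum_endpoints
    by (rule sum.cong) (auto simp: sent_through_def deliver_def vp Let_def emitted_snoc)
  also have "\<dots> = (\<Sum>y\<in>endpoints R. sent_through R C y) + (?s Port0 + ?s Port1)"
    using v by (simp add: sum.distrib sum_endpoints)
  finally show ?thesis by (simp add: deliver_def vp Let_def)
qed

section \<open>Directional bounds and the invariant\<close>

locale election_ring =
  fixes R :: ring and l :: nat
  assumes inj_ID: "inj_on (ID R) {..<num_nodes R}"
    and l_less: "l < num_nodes R"
    and ID_l: "ID R l = ID_max R"
begin

text \<open>The largest threshold among all nodes, in the direction of the pulses arriving at an endpoint.\<close>

definition bound :: "endpoint \<Rightarrow> nat" where
  "bound x = ID_max R +
     (if (snd x = next_port R (fst x)) = (Port1 = next_port R l) then 1 else 0)"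

lemma ID_le: "v < num_nodes R \<Longrightarrow> ID R v \<le> ID_max R"
  by (simp add: ID_max_def)

lemma ID_eq_max_iff: "v < num_nodes R \<Longrightarrow> ID R v = ID_max R \<longleftrightarrow> v = l"
  using inj_onD[OF inj_ID, of v l] l_less ID_l by auto

text \<open>By uniqueness every ID other than that of \<open>l\<close> is below
  \<open>ID_max R\<close>, which absorbs the extra 1 at \<open>Port1\<close>.\<close>

lemma threshold_le_bound:
  assumes "x \<in> endpoints R"
  shows "threshold (ID R (fst x)) (snd x) \<le> bound x"
proof -
  have "fst x < num_nodes R" using assms by (auto simp: endpoints_def)
  then show ?thesis
    using ID_le[of "fst x"] ID_eq_max_iff[of "fst x"]
    by (cases "fst x = l") (auto simp: threshold_def bound_def)
qed

lemma bound_at_l: "bound (l, p) = threshold (ID R l) p"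
  by (cases p; cases "next_port R l") (auto simp: bound_def threshold_def ID_l)

text \<open>Pulses arriving at \<open>flip x\<close> and at \<open>peer R x\<close> travel in the
  same direction, on which alone the bound depends.\<close>

lemma bound_peer: "x \<in> endpoints R \<Longrightarrow> bound (peer R x) = bound (flip x)"
  by (erule endpoint_cases) (simp_all add: peer_next peer_prev bound_def flip_def)

lemma sum_bound: "(\<Sum>x\<in>endpoints R. bound x) = num_nodes R * (2 * ID_max R + 1)"
proof -
  have "bound (v, Port0) + bound (v, Port1) = 2 * ID_max R + 1" for v
    by (cases "next_port R v"; cases "next_port R l") (auto simp: bound_def)
  then show ?thesis by (simp add: sum_endpoints)
qed

definition invariant :: "config \<Rightarrow> bool" where
  "invariant C \<longleftrightarrow>
     (\<forall>x\<in>endpoints R. transit C x + received C (peer R x) = sent_through R C x) \<and>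
     (\<forall>x\<in>endpoints R. received C x \<le> bound x) \<and>
     sent C = (\<Sum>x\<in>endpoints R. sent_through R C x)"

text \<open>The surplus pulse counts only while receipts are below the threshold, hence below the
  bound.\<close>

lemma sent_through_le_bound:
  assumes "invariant C" "x \<in> endpoints R"
  shows "sent_through R C x \<le> bound (flip x)"
proof -
  have "flip x \<in> endpoints R" using assms(2) by (auto simp: flip_def endpoints_def)
  then have "received C (flip x) \<le> bound (flip x)"
      "threshold (ID R (fst x)) (snd (flip x)) \<le> bound (flip x)"
    using assms(1) threshold_le_bound[of "flip x"] by (auto simp: invariant_def flip_def)
  then show ?thesis by (auto simp: sent_through_eq)
qed

lemma invariant_initial: "invariant (initial election R)"
  by (auto simp: invariant_def initial_def received_def sent_through_def emitted_Nil sum_endpoints)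

lemma invariant_deliver:
  assumes inv: "invariant C" and x: "x \<in> endpoints R" "0 < transit C x"
  shows "invariant (deliver election R x C)"
  unfolding invariant_def
proof (intro conjI ballI)
  fix y assume y: "y \<in> endpoints R"
  have "peer R y = peer R x \<longleftrightarrow> y = x" using peer_peer x(1) y by metis
  then show "transit (deliver election R x C) y + received (deliver election R x C) (peer R y) =
      sent_through R (deliver election R x C) y"
    using transit_deliver[of R x C y] inv x y
    by (auto simp: received_deliver invariant_def split: if_splits)
next
  fix y assume y: "y \<in> endpoints R"
  \<comment> \<open>The pulse in transit is already counted here, so there is room for its
    receipt.\<close>
  have "transit C x + received C (peer R x) \<le> bound (peer R x)"
    using inv x sent_through_le_bound[of C x] by (simp add: bound_peer invariant_def)
  then show "received (deliver election R x C) y \<le> bound y"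
    using inv x y by (auto simp: received_deliver invariant_def)
next
  show "sent (deliver election R x C) = (\<Sum>y\<in>endpoints R. sent_through R (deliver election R x C) y)"
    using sent_deliver[OF x(1), of C] inv by (simp add: invariant_def)
qed

lemma sent_le:
  assumes "invariant C"
  shows "sent C \<le> num_nodes R * (2 * ID_max R + 1)"
proof -
  have "sent C \<le> (\<Sum>x\<in>endpoints R. bound (flip x))"
    using assms sent_through_le_bound[OF assms] by (auto simp: invariant_def intro: sum_mono)
  also have "\<dots> = (\<Sum>x\<in>endpoints R. bound x)"
    by (rule sum.reindex_bij_betw[OF bij_flip])
  finally show ?thesis by (simp add: sum_bound)
qed

section \<open>Quiescent configurations\<close>

text \<open>With empty channels no node sends less than it received, so the inequality holds
  pointwise. Both \<open>flip\<close> and \<open>peer R\<close> permute the endpoints, so the two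
  sums agree and equality is forced: no surplus is left anywhere.\<close>

lemma quiescent_balanced:
  assumes inv: "invariant C" and q: "quiescent R C" and x: "x \<in> endpoints R"
  shows "received C (peer R x) = received C (flip x)" "sent_through R C x = received C (flip x)"
proof -
  have out: "received C (peer R y) = sent_through R C y" if "y \<in> endpoints R" for y
    using inv q that by (auto simp: invariant_def quiescent_def)
  then have le: "received C (flip y) \<le> received C (peer R y)" if "y \<in> endpoints R" for y
    using that by (simp add: sent_through_eq)
  have "(\<Sum>y\<in>endpoints R. received C (flip y)) = (\<Sum>y\<in>endpoints R. received C (peer R y))"
    by (simp only: sum.reindex_bij_betw[OF bij_flip] sum.reindex_bij_betw[OF bij_peer])
  then show "received C (peer R x) = received C (flip x)"
    using sum_mono_inv[of "\<lambda>y. received C (flip y)" "endpoints R" "\<lambda>y. received C (peer R y)" x]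
      le x by simp
  then show "sent_through R C x = received C (flip x)" using out x by simp
qed

lemma quiescent_received:
  assumes inv: "invariant C" and q: "quiescent R C" and x: "x \<in> endpoints R"
  shows "received C x = bound x"
proof -
  let ?n = "num_nodes R"
  let ?P = "\<lambda>v. \<forall>p. received C (v, p) = bound (v, p)"
  have at_l: "?P l"
  proof
    fix p
    have lp: "(l, other_port p) \<in> endpoints R" "(l, p) \<in> endpoints R"
      using l_less by (simp_all add: endpoints_def)
    \<comment> \<open>Without surplus, \<open>l\<close> must have reached its threshold, which
      equals the bound.\<close>
    have "threshold (ID R l) p \<le> received C (l, p)"
      using quiescent_balanced(2)[OF inv q lp(1)]
      by (simp add: sent_through_eq flip_def split: if_splits)
    moreover have "received C (l, p) \<le> bound (l, p)" using inv lp by (simp add: invariant_def)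
    ultimately show "received C (l, p) = bound (l, p)" by (simp add: bound_at_l)
  qed
  \<comment> \<open>Balance along the channel from \<open>v\<close> to its successor, applied from
    either end, transfers one port each.\<close>
  have step: "?P ((v + 1) mod ?n)" if v: "v < ?n" "?P v" for v
  proof
    fix p
    let ?w = "(v + 1) mod ?n"
    have mem: "(v, next_port R v) \<in> endpoints R" "(?w, other_port (next_port R ?w)) \<in> endpoints R"
      using v by (simp_all add: endpoints_def)
    have peers: "peer R (v, next_port R v) = (?w, other_port (next_port R ?w))"
      "peer R (?w, other_port (next_port R ?w)) = (v, next_port R v)"
      using peer_peer[OF mem(1)] by (simp_all add: peer_next)
    show "received C (?w, p) = bound (?w, p)"
    proof (cases "p = next_port R ?w")
      case True
      then show ?thesis
        using quiescent_balanced(1)[OF inv q mem(2)] bound_peer[OF mem(2)] v(2)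
        by (simp only: peers) (simp add: flip_def)
    next
      case False
      then have "p = other_port (next_port R ?w)" by (simp add: neq_port_iff)
      then show ?thesis
        using quiescent_balanced(1)[OF inv q mem(1)] bound_peer[OF mem(1)] v(2)
        by (simp only: peers) (simp add: flip_def)
    qed
  qed
  have reach: "?P ((l + k) mod ?n)" for k
  proof (induction k)
    case 0
    then show ?case using at_l l_less by simp
  next
    case (Suc k)
    then show ?case using step[of "(l + k) mod ?n"] l_less by (simp add: mod_Suc_eq)
  qed
  obtain v p where vp: "x = (v, p)" "v < ?n" using x by (auto simp: endpoints_def)
  have "?P v" using reach[of "v + ?n - l"] l_less vp(2) by simp
  then show ?thesis using vp by simp
qed

lemma quiescent_sent:
  assumes inv: "invariant C" and q: "quiescent R C"
  shows "sent C = num_nodes R * (2 * ID_max R + 1)"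
proof -
  have "sent_through R C x = bound (flip x)" if x: "x \<in> endpoints R" for x
    using quiescent_balanced[OF inv q x] quiescent_received[OF inv q peer_in_endpoints[OF x]]
    by (simp add: bound_peer x)
  then have "sent C = (\<Sum>x\<in>endpoints R. bound (flip x))"
    using inv by (simp add: invariant_def)
  also have "\<dots> = (\<Sum>x\<in>endpoints R. bound x)"
    by (rule sum.reindex_bij_betw[OF bij_flip])
  finally show ?thesis by (simp add: sum_bound)
qed

lemma quiescent_count:
  assumes "invariant C" "quiescent R C" "v < num_nodes R"
  shows "count_list (history C v) p = bound (v, p)"
  using quiescent_received[OF assms(1,2), of "(v, p)"] assms(3)
  by (simp add: received_def endpoints_def)

lemma quiescent_elected:
  assumes inv: "invariant C" and q: "quiescent R C"
  shows "elected election R C"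
proof -
  have "role election (ID R v) (history C v) = (if v = l then Leader else Non_Leader)"
    if v: "v < num_nodes R" for v
  proof -
    \<comment> \<open>Every node sees this maximum, so the \<open>role\<close> test singles out the
      node whose ID is \<open>ID_max R\<close>.\<close>
    have "max (bound (v, Port0)) (bound (v, Port1)) = ID_max R + 1"
      by (cases "next_port R v"; cases "next_port R l") (auto simp: bound_def)
    then show ?thesis
      using ID_eq_max_iff[OF v] by (auto simp: election_def quiescent_count[OF inv q v])
  qed
  then show ?thesis using l_less by (auto simp: elected_def)
qed

lemma quiescent_oriented:
  assumes inv: "invariant C" and q: "quiescent R C"
  shows "oriented election R C"
proof -
  \<comment> \<open>The larger bound belongs to the direction of arrivals at \<open>Port1\<close> of
    \<open>l\<close>, so all nodes choose consistently.\<close>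
  have cw: "clockwise election (ID R v) (history C v) =
      {if next_port R l = Port1 then next_port R v else other_port (next_port R v)}"
    if v: "v < num_nodes R" for v
  proof -
    have "bound (v, other_port p) < bound (v, p) \<longleftrightarrow>
        p = (if next_port R l = Port1 then next_port R v else other_port (next_port R v))" for p
      by (cases p; cases "next_port R v"; cases "next_port R l") (auto simp: bound_def)
    then show ?thesis by (simp add: election_def quiescent_count[OF inv q v])
  qed
  show ?thesis
  proof (cases "next_port R l = Port1")
    case True
    then show ?thesis using cw next_port_covers_edges unfolding oriented_def
      by (intro exI[of _ "next_port R"]) simp
  next
    case False
    then show ?thesis using cw prev_port_covers_edges unfolding oriented_def
      by (intro exI[of _ "\<lambda>w. other_port (next_port R w)"]) simp
  qed
qed

section \<open>Executions\<close>

text \<open>The safety half of \<open>admissible\<close>, separated so that termination can be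
  proved before fairness is known.\<close>

definition legal :: "schedule \<Rightarrow> bool" where
  "legal \<sigma> \<longleftrightarrow>
     (\<forall>t x. \<sigma> t = Some x \<longrightarrow> x \<in> endpoints R \<and> 0 < transit (run election R \<sigma> t) x)"

lemma invariant_run: "legal \<sigma> \<Longrightarrow> invariant (run election R \<sigma> t)"
  by (induction t)
     (auto simp: invariant_initial legal_def intro: invariant_deliver split: option.split)

text \<open>Every delivery increases the number of received pulses, which is bounded.\<close>

lemma eventually_quiescent:
  assumes legal: "legal \<sigma>"
    and live: "\<And>t. \<not> quiescent R (run election R \<sigma> t) \<Longrightarrow> \<exists>t'\<ge>t. \<sigma> t' \<noteq> None"
  shows "\<exists>t\<ge>t0. quiescent R (run election R \<sigma> t)"
proof -
  define f where "f t = (\<Sum>x\<in>endpoints R. received (run election R \<sigma> t) x)" for t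
  have step: "f (Suc t) = f t + (if \<sigma> t = None then 0 else 1)" for t
  proof (cases "\<sigma> t")
    case (Some x)
    then have "peer R x \<in> endpoints R" using legal peer_in_endpoints unfolding legal_def by blast
    then show ?thesis using Some by (simp add: f_def received_deliver sum.distrib)
  qed (simp add: f_def)
  have mono: "t \<le> t' \<Longrightarrow> f t \<le> f t'" for t t'
    by (rule lift_Suc_mono_le[of f]) (auto simp: step)
  have "f t \<le> (\<Sum>x\<in>endpoints R. bound x)" for t
    using invariant_run[OF legal, of t] by (auto simp: f_def invariant_def intro: sum_mono)
  then obtain t where t: "t \<ge> t0" "\<And>t'. t' \<ge> t0 \<Longrightarrow> f t' \<le> f t"
    using ex_has_greatest_nat[of "\<lambda>t. t \<ge> t0" t0 f "(\<Sum>x\<in>endpoints R. bound x) + 1"]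
    by (auto simp: less_Suc_eq_le)
  have "quiescent R (run election R \<sigma> t)"
  proof (rule ccontr)
    assume "\<not> ?thesis"
    then obtain t' where "t' \<ge> t" "\<sigma> t' \<noteq> None" using live by blast
    then show False using step[of t'] mono[of t t'] t(1) t(2)[of "Suc t'"] by (auto simp del: not_None_eq)
  qed
  then show ?thesis using t(1) by blast
qed

lemma admissible_legal: "admissible election R \<sigma> \<Longrightarrow> legal \<sigma>"
  by (simp add: admissible_def legal_def)

lemma admissible_quiescent:
  assumes "admissible election R \<sigma>"
  shows "\<exists>t. quiescent R (run election R \<sigma> t)"
proof -
  have "\<exists>t'\<ge>t. \<sigma> t' \<noteq> None" if "\<not> quiescent R (run election R \<sigma> t)" for t
    using assms that unfolding admissible_def quiescent_def by (metis neq0_conv option.distinct(1))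
  then show ?thesis using eventually_quiescent[OF admissible_legal[OF assms]] by blast
qed

text \<open>Makes the supremum in the complexity range over a nonempty set. Serving any nonempty
  channel is fair here: a channel never served would stay nonempty, contradicting eventual
  quiescence.\<close>

lemma ex_admissible: "\<exists>\<sigma>. admissible election R \<sigma>"
proof -
  define pick where "pick C = (if quiescent R C then None
    else Some (SOME x. x \<in> endpoints R \<and> 0 < transit C x))" for C
  \<comment> \<open>Schedule and run depend on each other, so the configurations are built
    first.\<close>
  define G where "G = rec_nat (initial election R)
    (\<lambda>_ C. case pick C of None \<Rightarrow> C | Some x \<Rightarrow> deliver election R x C)"
  define \<sigma> where "\<sigma> t = pick (G t)" for t
  have run: "run election R \<sigma> t = G t" for t
    by (induction t) (simp_all add: G_def \<sigma>_def cong: option.case_cong)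
  have "x \<in> endpoints R \<and> 0 < transit C x" if "pick C = Some x" for C x
    using that someI_ex[of "\<lambda>x. x \<in> endpoints R \<and> 0 < transit C x"]
    by (auto simp: pick_def quiescent_def split: if_splits)
  then have legal: "legal \<sigma>" by (simp add: legal_def run) (simp add: \<sigma>_def)
  have live: "\<exists>t'\<ge>t. \<sigma> t' \<noteq> None" if "\<not> quiescent R (run election R \<sigma> t)" for t
    using that by (auto simp: run \<sigma>_def pick_def)
  have "\<exists>t'\<ge>t. \<sigma> t' = Some x"
    if x: "x \<in> endpoints R" and pos: "0 < transit (run election R \<sigma> t) x" for t x
  proof (rule ccontr)
    assume never: "\<not> ?thesis"
    have "0 < transit (run election R \<sigma> t') x" if "t' \<ge> t" for t'
      using that
    proof (induction t' rule: dec_induct)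
      case (step m)
      then have "\<sigma> m \<noteq> Some x" using never by auto
      with step.IH show ?case
        by (auto simp: deliver_def Let_def split: option.split prod.split)
    qed (rule pos)
    moreover obtain t' where "t' \<ge> t" "quiescent R (run election R \<sigma> t')"
      using eventually_quiescent[OF legal live] by blast
    ultimately show False using x unfolding quiescent_def by (metis less_irrefl)
  qed
  then have "admissible election R \<sigma>" using legal by (simp add: admissible_def legal_def)
  then show ?thesis by blast
qed

section \<open>Correctness and exact message complexity\<close>

lemma election_stabilizes:
  "quiescently_stabilizes election R (\<lambda>C. elected election R C \<and> oriented election R C)"
  unfolding quiescently_stabilizes_def
  using admissible_quiescent invariant_run[OF admissible_legal] quiescent_elected
    quiescent_oriented by blast

lemma election_complexity:
  "message_complexity election R = enat (num_nodes R * (2 * ID_max R + 1))"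
proof (rule antisym)
  show "message_complexity election R \<le> enat (num_nodes R * (2 * ID_max R + 1))"
    unfolding message_complexity_def
    using sent_le[OF invariant_run[OF admissible_legal]] by (intro SUP_least) auto
next
  \<comment> \<open>Any quiescent configuration attains the bound exactly, so one execution
    suffices.\<close>
  obtain \<sigma> t where \<sigma>: "admissible election R \<sigma>" "quiescent R (run election R \<sigma> t)"
    using ex_admissible admissible_quiescent by blast
  then have "sent (run election R \<sigma> t) = num_nodes R * (2 * ID_max R + 1)"
    using quiescent_sent invariant_run[OF admissible_legal] by blast
  then show "enat (num_nodes R * (2 * ID_max R + 1)) \<le> message_complexity election R"
    unfolding message_complexity_def
    using \<sigma>(1) by (intro SUP_upper2[of \<sigma>] SUP_upper2[of t]) auto
qed

end

lemma valid_ring_election_ring: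
  assumes "valid_ring R"
  shows "\<exists>l. election_ring R l"
proof -
  have "ID_max R \<in> ID R ` {..<num_nodes R}"
    using assms unfolding ID_max_def valid_ring_def by (intro Max_in) (auto simp: lessThan_empty_iff)
  then show ?thesis using assms by (auto simp: election_ring_def valid_ring_def)
qed

theorem theorem1p2:
  "\<exists>A :: algorithm. \<forall>R :: ring. valid_ring R \<longrightarrow>
     quiescently_stabilizes A R (\<lambda>C. elected A R C \<and> oriented A R C) \<and>
     message_complexity A R = enat (num_nodes R * (2 * ID_max R + 1))"
  using valid_ring_election_ring election_ring.election_stabilizes
    election_ring.election_complexity by blast

end
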